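(* Let $M$ be a closed, connected, orientable $\mathrm{PL}$ manifold of dimension $d$ with fundamental group $\Gamma=\pi_1(M,m_0)$. Let $$\Gamma=\Gamma_1\supset\Gamma_2\supset\Gamma_3\supset\cdots\supset\Gamma_i\supset\cdots$$ be a chain of (not necessarily normal) subgroups, each of finite index greater than $1$ in the preceding one, and let $$C=\varprojlim\{\Gamma/\Gamma_1\leftarrow\Gamma/\Gamma_2\leftarrow\cdots\leftarrow\Gamma/\Gamma_i\leftarrow\cdots\}$$ be the associated Cantor set, with the natural minimal action of $\Gamma$ given by translation in each factor. Then the action of $\Gamma$ on $C$ is uniquely ergodic.
   Context: $\Gamma/\Gamma_i$ is the finite discrete set of cosets $g\Gamma_i$, the bonding maps are the natural projections $g\Gamma_{i+1}\mapsto g\Gamma_i$, and the action is $\gamma\cdot(g_i\Gamma_i)_i=(\gamma g_i\Gamma_i)_i$. An action is uniquely ergodic if it has exactly one invariant Borel probability measure. *)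

theory Defs
  imports
    "HOL-Homology.Homology"
    "HOL-Probability.Probability"
    "HOL-Algebra.Left_Coset"
    "HOL-Algebra.Generated_Groups"
begin

section \<open>Piecewise-linear manifolds\<close>

text \<open>
  Polyhedra and PL maps in the sense of Rourke and Sanderson: subsets of a Euclidean space
  which near each of their points are finite unions of convex polytopes, and maps which near each
  point are affine on each member of such a finite family.  (The library constant
  \<open>polyhedron\<close> means something else, namely a finite intersection of closed half-spaces.)
\<close>

definition polytopal_nhd :: "'a::euclidean_space set \<Rightarrow> 'a \<Rightarrow> 'a set set \<Rightarrow> bool" where
  "polytopal_nhd X a F \<longleftrightarrow>
     finite F \<and> (\<forall>P\<in>F. polytope P) \<and> \<Union>F \<subseteq> X \<and> a \<in> (top_of_set X) interior_of \<Union>F"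

definition pl_polyhedron :: "'a::euclidean_space set \<Rightarrow> bool" where
  "pl_polyhedron X \<longleftrightarrow> (\<forall>a\<in>X. \<exists>F. polytopal_nhd X a F)"

definition pl_on :: "'a::euclidean_space set \<Rightarrow> ('a \<Rightarrow> 'b::euclidean_space) \<Rightarrow> bool" where
  "pl_on X f \<longleftrightarrow>
     continuous_on X f \<and>
     (\<forall>a\<in>X. \<exists>F. polytopal_nhd X a F \<and> (\<forall>P\<in>F. \<exists>L b. linear L \<and> (\<forall>x\<in>P. f x = L x + b)))"

definition pl_homeomorphic :: "'a::euclidean_space set \<Rightarrow> 'b::euclidean_space set \<Rightarrow> bool" where
  "pl_homeomorphic X Y \<longleftrightarrow> (\<exists>f g. homeomorphism X Y f g \<and> pl_on X f \<and> pl_on Y g)"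

text \<open>
  PL manifolds without boundary.  The model space \<open>\<real>\<^sup>d\<close> is a \<open>d\<close>-dimensional linear subspace
  of the ambient Euclidean space.  It always exists when \<open>M\<close> is nonempty, since the dimension of a
  manifold does not exceed that of the ambient space; and unlike a type \<open>real ^ 'n\<close> it
  allows \<open>d = 0\<close>.
\<close>

definition pl_manifold :: "nat \<Rightarrow> 'a::euclidean_space set \<Rightarrow> bool" where
  "pl_manifold d M \<longleftrightarrow>
     pl_polyhedron M \<and>
     (\<forall>a\<in>M. \<exists>U V W. openin (top_of_set M) U \<and> a \<in> U \<and>
        subspace (V :: 'a set) \<and> dim V = d \<and> openin (top_of_set V) W \<and> pl_homeomorphic U W)"

text \<open>
  An orientation is a choice of generators of the local homology groups \<open>H\<^sub>d(X, X - {x})\<close> which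
  near every point is induced by a single class in \<open>H\<^sub>d(X, X - U)\<close>.
\<close>

definition orientation_on :: "nat \<Rightarrow> 'a topology \<Rightarrow> ('a \<Rightarrow> 'a chain set) \<Rightarrow> bool" where
  "orientation_on d X \<mu> \<longleftrightarrow>
     (\<forall>x\<in>topspace X.
        \<mu> x \<in> carrier (relative_homology_group (int d) X (topspace X - {x})) \<and>
        generate (relative_homology_group (int d) X (topspace X - {x})) {\<mu> x}
          = carrier (relative_homology_group (int d) X (topspace X - {x}))) \<and>
     (\<forall>x\<in>topspace X. \<exists>U c. openin X U \<and> x \<in> U \<and>
        c \<in> carrier (relative_homology_group (int d) X (topspace X - U)) \<and>
        (\<forall>y\<in>U. hom_induced (int d) X (topspace X - U) X (topspace X - {y}) id c = \<mu> y))"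

definition orientable :: "nat \<Rightarrow> 'a topology \<Rightarrow> bool" where
  "orientable d X \<longleftrightarrow> (\<exists>\<mu>. orientation_on d X \<mu>)"


section \<open>The fundamental group\<close>

definition loop_class :: "'a::real_normed_vector set \<Rightarrow> (real \<Rightarrow> 'a) \<Rightarrow> (real \<Rightarrow> 'a) set" where
  "loop_class S p = {q. homotopic_paths S p q}"

definition fundamental_group ::
    "'a::real_normed_vector set \<Rightarrow> 'a \<Rightarrow> (real \<Rightarrow> 'a) set monoid" where
  "fundamental_group S a =
     \<lparr>carrier = loop_class S `
        {p. path p \<and> path_image p \<subseteq> S \<and> pathstart p = a \<and> pathfinish p = a},
      monoid.mult = (\<lambda>A B. \<Union>p\<in>A. \<Union>q\<in>B. loop_class S (p +++ q)),
      one = loop_class S (linepath a a)\<rparr>"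

lemma loop_class_eq:
  "homotopic_paths S p q \<Longrightarrow> loop_class S p = loop_class S q"
  unfolding loop_class_def by (blast intro: homotopic_paths_sym homotopic_paths_trans)

lemma fundamental_group_mult:
  assumes "path p" "path_image p \<subseteq> S" "path q" "path_image q \<subseteq> S" "pathfinish p = pathstart q"
  shows "loop_class S p \<otimes>\<^bsub>fundamental_group S a\<^esub> loop_class S q = loop_class S (p +++ q)"
proof -
  have "loop_class S (p' +++ q') = loop_class S (p +++ q)"
    if "p' \<in> loop_class S p" "q' \<in> loop_class S q" for p' q'
    using that assms unfolding loop_class_def[of S p] loop_class_def[of S q]
    by (metis homotopic_paths_join loop_class_eq mem_Collect_eq)
  moreover have "p \<in> loop_class S p" "q \<in> loop_class S q"
    using assms by (auto simp: loop_class_def)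
  ultimately have "(\<Union>p'\<in>loop_class S p. \<Union>q'\<in>loop_class S q. loop_class S (p' +++ q'))
      = loop_class S (p +++ q)"
    by blast
  then show ?thesis
    by (simp add: fundamental_group_def)
qed

lemma group_fundamental_group:
  assumes "a \<in> S"
  shows "group (fundamental_group S a)" (is "group ?G")
proof -
  let ?L = "{p. path p \<and> path_image p \<subseteq> S \<and> pathstart p = a \<and> pathfinish p = a}"
  have carr: "carrier ?G = loop_class S ` ?L" and one: "\<one>\<^bsub>?G\<^esub> = loop_class S (linepath a a)"
    by (simp_all add: fundamental_group_def)
  have mult: "loop_class S p \<otimes>\<^bsub>?G\<^esub> loop_class S q = loop_class S (p +++ q)"
    if "p \<in> ?L" "q \<in> ?L" for p q
    using that by (intro fundamental_group_mult) auto
  have join: "p +++ q \<in> ?L" if "p \<in> ?L" "q \<in> ?L" for p q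
    using that by (auto intro: subsetD[OF subset_path_image_join])
  have const: "linepath a a \<in> ?L" using assms by auto
  show ?thesis
  proof (rule groupI)
    fix A B assume "A \<in> carrier ?G" "B \<in> carrier ?G"
    then show "A \<otimes>\<^bsub>?G\<^esub> B \<in> carrier ?G"
      unfolding carr using mult join by (elim imageE) (simp only: imageI)
  next
    show "\<one>\<^bsub>?G\<^esub> \<in> carrier ?G" unfolding carr one using const by blast
  next
    fix A B C assume "A \<in> carrier ?G" "B \<in> carrier ?G" "C \<in> carrier ?G"
    then obtain p q r where pqr: "p \<in> ?L" "q \<in> ?L" "r \<in> ?L"
      and ABC: "A = loop_class S p" "B = loop_class S q" "C = loop_class S r"
      unfolding carr by blast
    have "homotopic_paths S (p +++ (q +++ r)) ((p +++ q) +++ r)"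
      using pqr by (intro homotopic_paths_assoc) auto
    then show "A \<otimes>\<^bsub>?G\<^esub> B \<otimes>\<^bsub>?G\<^esub> C = A \<otimes>\<^bsub>?G\<^esub> (B \<otimes>\<^bsub>?G\<^esub> C)"
      unfolding ABC mult[OF pqr(1,2)] mult[OF pqr(2,3)]
        mult[OF join[OF pqr(1,2)] pqr(3)] mult[OF pqr(1) join[OF pqr(2,3)]]
      by (metis loop_class_eq)
  next
    fix A assume "A \<in> carrier ?G"
    then obtain p where p: "p \<in> ?L" "A = loop_class S p" unfolding carr by blast
    have "homotopic_paths S (linepath a a +++ p) p"
      using p(1) by (intro homotopic_paths_lid') auto
    then show "\<one>\<^bsub>?G\<^esub> \<otimes>\<^bsub>?G\<^esub> A = A"
      unfolding one p(2) mult[OF const p(1)] by (rule loop_class_eq)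
    have "homotopic_paths S (reversepath p +++ p) (linepath a a)"
      using homotopic_paths_linv[of p S] p(1) by auto
    moreover have r: "reversepath p \<in> ?L" using p(1) by auto
    ultimately have "loop_class S (reversepath p) \<otimes>\<^bsub>?G\<^esub> A = \<one>\<^bsub>?G\<^esub>"
      unfolding one p(2) mult[OF r p(1)] by (intro loop_class_eq)
    then show "\<exists>B\<in>carrier ?G. B \<otimes>\<^bsub>?G\<^esub> A = \<one>\<^bsub>?G\<^esub>"
      unfolding carr using r by blast
  qed
qed


section \<open>The inverse limit of coset spaces\<close>

text \<open>
  The chain is indexed from \<open>0\<close>, so \<open>H i\<close> is the subgroup usually written \<open>\<Gamma>\<^bsub>i+1\<^esub>\<close>.
  Indices are numbers of left cosets of \<open>H (Suc i)\<close> in the group \<open>H i\<close>.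
\<close>

definition finite_index_chain :: "('g, 'b) monoid_scheme \<Rightarrow> (nat \<Rightarrow> 'g set) \<Rightarrow> bool" where
  "finite_index_chain G H \<longleftrightarrow>
     H 0 = carrier G \<and>
     (\<forall>i. subgroup (H i) G \<and> H (Suc i) \<subseteq> H i \<and>
          finite (lcosets\<^bsub>G\<lparr>carrier := H i\<rparr>\<^esub> H (Suc i)) \<and>
          card (lcosets\<^bsub>G\<lparr>carrier := H i\<rparr>\<^esub> H (Suc i)) > 1)"

text \<open>
  The projection \<open>G/K' \<rightarrow> G/K\<close> for \<open>K' \<subseteq> K\<close>, written as multiplication of a left coset
  by \<open>K\<close>; the lemma below is the usual description on representatives.
\<close>

definition coset_proj :: "('g, 'b) monoid_scheme \<Rightarrow> 'g set \<Rightarrow> 'g set \<Rightarrow> 'g set" where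
  "coset_proj G K A = A <#>\<^bsub>G\<^esub> K"

lemma (in group) coset_proj_l_coset:
  assumes "subgroup K G" "subgroup K' G" "K' \<subseteq> K" "g \<in> carrier G"
  shows "coset_proj G K (g <# K') = g <# K"
proof -
  have "K' <#> K = K"
  proof
    show "K' <#> K \<subseteq> K"
      using assms(3) subgroup.m_closed[OF assms(1)] by (auto simp: set_mult_def)
    show "K \<subseteq> K' <#> K"
    proof
      fix k assume k: "k \<in> K"
      then have "k = \<one> \<otimes> k" using subgroup.mem_carrier[OF assms(1)] by simp
      then show "k \<in> K' <#> K"
        using k subgroup.one_closed[OF assms(2)] unfolding set_mult_def by blast
    qed
  qed
  moreover have "(g <# K') <#> K = g <# (K' <#> K)"
    using assms by (simp add: l_coset_eq_set_mult set_mult_assoc subgroup.subset)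
  ultimately show ?thesis by (simp add: coset_proj_def)
qed

definition coset_limit :: "('g, 'b) monoid_scheme \<Rightarrow> (nat \<Rightarrow> 'g set) \<Rightarrow> (nat \<Rightarrow> 'g set) set" where
  "coset_limit G H =
     {x. \<forall>i. x i \<in> lcosets\<^bsub>G\<^esub> (H i) \<and> coset_proj G (H i) (x (Suc i)) = x i}"

definition coset_limit_topology ::
    "('g, 'b) monoid_scheme \<Rightarrow> (nat \<Rightarrow> 'g set) \<Rightarrow> (nat \<Rightarrow> 'g set) topology" where
  "coset_limit_topology G H =
     subtopology (product_topology (\<lambda>i. discrete_topology (lcosets\<^bsub>G\<^esub> (H i))) UNIV)
       (coset_limit G H)"

definition translation :: "('g, 'b) monoid_scheme \<Rightarrow> 'g \<Rightarrow> (nat \<Rightarrow> 'g set) \<Rightarrow> (nat \<Rightarrow> 'g set)" where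
  "translation G g x = (\<lambda>i. g <#\<^bsub>G\<^esub> x i)"

lemma topspace_coset_limit_topology: "topspace (coset_limit_topology G H) = coset_limit G H"
  by (auto simp: coset_limit_topology_def coset_limit_def)

lemma (in group) translation_in_coset_limit:
  assumes H: "\<And>i. subgroup (H i) G" and g: "g \<in> carrier G" and x: "x \<in> coset_limit G H"
  shows "translation G g x \<in> coset_limit G H"
proof -
  have "g <# x i \<in> lcosets (H i) \<and> coset_proj G (H i) (g <# x (Suc i)) = g <# x i" for i
  proof -
    have xi: "x i \<in> lcosets (H i)" "x (Suc i) \<in> lcosets (H (Suc i))"
      and pr: "x (Suc i) <#> H i = x i"
      using x by (auto simp: coset_limit_def coset_proj_def)
    then obtain a where a: "a \<in> carrier G" "x i = a <# H i" by (auto simp: LCOSETS_def)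
    have "g <# x i = (g \<otimes> a) <# H i"
      using a g subgroup.subset[OF H] by (simp add: lcos_m_assoc)
    then have 1: "g <# x i \<in> lcosets (H i)" using a g by (auto simp: LCOSETS_def)
    have sub: "x (Suc i) \<subseteq> carrier G"
      using lcosets_subset_PowG[OF H] xi(2) by blast
    have "(g <# x (Suc i)) <#> H i = g <# x i"
      using g sub subgroup.subset[OF H]
      by (simp add: l_coset_eq_set_mult set_mult_assoc flip: pr)
    then show ?thesis using 1 by (simp add: coset_proj_def)
  qed
  then show ?thesis by (simp add: coset_limit_def translation_def)
qed


section \<open>Unique ergodicity\<close>

definition invariant_borel_prob ::
    "('g, 'b) monoid_scheme \<Rightarrow> 'x topology \<Rightarrow> ('g \<Rightarrow> 'x \<Rightarrow> 'x) \<Rightarrow> 'x measure \<Rightarrow> bool" where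
  "invariant_borel_prob G X \<phi> \<mu> \<longleftrightarrow>
     sets \<mu> = sets (sigma (topspace X) {U. openin X U}) \<and> prob_space \<mu> \<and>
     (\<forall>g\<in>carrier G. \<forall>A\<in>sets \<mu>. emeasure \<mu> {x \<in> topspace X. \<phi> g x \<in> A} = emeasure \<mu> A)"

definition uniquely_ergodic ::
    "('g, 'b) monoid_scheme \<Rightarrow> 'x topology \<Rightarrow> ('g \<Rightarrow> 'x \<Rightarrow> 'x) \<Rightarrow> bool" where
  "uniquely_ergodic G X \<phi> \<longleftrightarrow> (\<exists>!\<mu>. invariant_borel_prob G X \<phi> \<mu>)"

end

theory Submission
  imports Defs
begin

text \<open>
  Let \<open>\<Gamma> = \<pi>\<^sub>1(M, m\<^sub>0)\<close> and let \<open>C\<close> be the inverse limit of the \<open>\<Gamma> / H i\<close>.  Call the set of all points of \<open>C\<close> whose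
  \<open>i\<close>-th coordinate is a given coset a cylinder of level \<open>i\<close>.  Two cylinders are nested or
  disjoint, and, there being countably many of them, they generate the Borel sets of \<open>C\<close>.  The
  group permutes the finitely many cylinders of each level transitively.

  An invariant probability measure thus gives equal mass to all cylinders of a level, that
  is, mass \<open>1 / [\<Gamma> : H i]\<close>.  Conversely, a probability measure with this property is
  determined by it (\<open>equidistributed_unique\<close>), and since its translates have the same property, it
  is invariant.  So it remains to find one such measure (\<open>equidistributed_exists\<close>).  Choose a finite
  transversal \<open>T i\<close> of the left cosets of \<open>H (Suc i)\<close> in \<open>H i\<close>.  Independent uniformly
  distributed \<open>t\<^sub>i \<in> T i\<close> give the random point of \<open>C\<close> whose \<open>i\<close>-th coordinate is
  \<open>t\<^sub>0 \<cdots> t\<^sub>i\<^sub>-\<^sub>1 H i\<close>.  This coordinate equals a given coset for exactly one choice of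
  \<open>t\<^sub>0, \<dots>, t\<^sub>i\<^sub>-\<^sub>1\<close>, so all cylinders of level \<open>i\<close> have the same probability.
\<close>

section \<open>Cylinders of the inverse limit\<close>

text \<open>A group with a chain of subgroups, each of finite index in the preceding one.\<close>

locale coset_chain = group G for G (structure) +
  fixes H :: "nat \<Rightarrow> 'a set"
  assumes chain: "finite_index_chain G H"
begin

lemma H_0: "H 0 = carrier G"
  and subgroup_H [simp, intro]: "subgroup (H i) G"
  and H_Suc_subset: "H (Suc i) \<subseteq> H i"
  using chain by (auto simp: finite_index_chain_def)

lemma H_carrier: "h \<in> H i \<Longrightarrow> h \<in> carrier G"
  using subgroup.mem_carrier subgroup_H by metis

lemma H_subset [simp]: "H i \<subseteq> carrier G"
  using H_carrier by blast

lemma coset_proj_Suc: "g \<in> carrier G \<Longrightarrow> coset_proj G (H i) (g <# H (Suc i)) = g <# H i"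
  by (rule coset_proj_l_coset) (auto simp: H_Suc_subset)

lemma lcosetsE:
  assumes "A \<in> lcosets (H i)"
  obtains a where "a \<in> carrier G" "A = a <# H i"
  using assms by (auto simp: LCOSETS_def)

lemma l_coset_in_lcosets: "a \<in> carrier G \<Longrightarrow> a <# H i \<in> lcosets (H i)"
  by (auto simp: LCOSETS_def)

lemma l_coset_eq_iff:
  assumes "a \<in> carrier G" "b \<in> carrier G"
  shows "a <# H i = b <# H i \<longleftrightarrow> inv a \<otimes> b \<in> H i"
proof
  assume "a <# H i = b <# H i"
  then have "b \<in> a <# H i" using lcos_self[OF assms(2)] by simp
  then show "inv a \<otimes> b \<in> H i"
    using subgroup.lcos_module_imp[OF subgroup_H is_group assms(1)] by blast
next
  assume "inv a \<otimes> b \<in> H i"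
  then have "b \<in> a <# H i"
    using subgroup.lcos_module_rev[OF subgroup_H is_group assms] by blast
  then show "a <# H i = b <# H i"
    using l_repr_independence assms(1) by blast
qed

abbreviation C :: "(nat \<Rightarrow> 'a set) set" where
  "C \<equiv> coset_limit G H"

abbreviation Borel :: "(nat \<Rightarrow> 'a set) measure" where
  "Borel \<equiv> sigma C {U. openin (coset_limit_topology G H) U}"

text \<open>The set of all points of the limit with \<open>i\<close>-th coordinate \<open>A\<close>.\<close>

definition cyl :: "nat \<Rightarrow> 'a set \<Rightarrow> (nat \<Rightarrow> 'a set) set" where
  "cyl i A = {x \<in> C. x i = A}"

definition cylinders :: "(nat \<Rightarrow> 'a set) set set" where
  "cylinders = {cyl i A |i A. A \<in> lcosets (H i)}"

lemma limit_coord: "x \<in> C \<Longrightarrow> x i \<in> lcosets (H i)"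
  and limit_proj: "x \<in> C \<Longrightarrow> coset_proj G (H i) (x (Suc i)) = x i"
  by (auto simp: coset_limit_def)

lemma limit_coord_eq_below:
  assumes "x \<in> C" "y \<in> C" "i \<le> j" "x j = y j"
  shows "x i = y i"
  using assms(3)
proof (induction rule: inc_induct)
  case base
  show ?case by (rule assms(4))
next
  case (step n)
  then show ?case using limit_proj[OF assms(1), of n] limit_proj[OF assms(2), of n] by simp
qed

lemma cyl_subset: "cyl i A \<subseteq> C"
  by (auto simp: cyl_def)

lemma cyl_in_cylinders: "A \<in> lcosets (H i) \<Longrightarrow> cyl i A \<in> cylinders"
  by (auto simp: cylinders_def)

lemma cylinders_nested:
  assumes "i \<le> j"
  shows "cyl i A \<inter> cyl j B \<in> {{}, cyl j B}"
proof (cases "cyl i A \<inter> cyl j B = {}")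
  case False
  then obtain z where z: "z \<in> C" "z i = A" "z j = B" by (auto simp: cyl_def)
  have "y i = A" if "y \<in> C" "y j = B" for y
    using limit_coord_eq_below[OF that(1) z(1) assms] that(2) z by simp
  then have "cyl j B \<subseteq> cyl i A" by (auto simp: cyl_def)
  then show ?thesis by blast
qed simp

text \<open>The empty set is added as the intersection of disjoint cylinders.\<close>

lemma Int_stable_cylinders: "Int_stable (insert {} cylinders)"
proof -
  have *: "cyl i A \<inter> cyl j B \<in> insert {} cylinders"
    if "A \<in> lcosets (H i)" "B \<in> lcosets (H j)" for i j A B
  proof (cases "i \<le> j")
    case True
    then show ?thesis using cylinders_nested[of i j A B] cyl_in_cylinders[OF that(2)] by auto
  next
    case False
    then have "j \<le> i" by simp
    then show ?thesis
      using cylinders_nested[of j i B A] cyl_in_cylinders[OF that(1)] by (auto simp: Int_commute)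
  qed
  have "D \<inter> E \<in> insert {} cylinders" if D: "D \<in> cylinders" and E: "E \<in> cylinders" for D E
  proof -
    obtain i A j B where "A \<in> lcosets (H i)" "B \<in> lcosets (H j)" "D = cyl i A" "E = cyl j B"
      using D E unfolding cylinders_def by blast
    then show ?thesis using * by simp
  qed
  then show ?thesis
    by (auto simp: Int_stable_def)
qed

lemma openin_cyl:
  assumes "A \<in> lcosets (H i)"
  shows "openin (coset_limit_topology G H) (cyl i A)"
proof -
  have "continuous_map (coset_limit_topology G H) (discrete_topology (lcosets (H i))) (\<lambda>x. x i)"
    unfolding coset_limit_topology_def
    by (intro continuous_map_from_subtopology continuous_map_product_projection) simp
  from openin_continuous_map_preimage[OF this, of "{A}"] show ?thesis
    using assms by (simp add: topspace_coset_limit_topology cyl_def)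
qed

text \<open>The cylinders form a base of the topology.\<close>

lemma open_contains_cyl:
  assumes "openin (coset_limit_topology G H) U" "x \<in> U"
  obtains n where "cyl n (x n) \<subseteq> U"
proof -
  obtain V where V: "openin (product_topology (\<lambda>i. discrete_topology (lcosets (H i))) UNIV) V"
    and U: "U = V \<inter> C"
    using assms(1) by (auto simp: coset_limit_topology_def openin_subtopology)
  obtain W where fin: "finite {i. W i \<noteq> lcosets (H i)}"
    and W: "x \<in> Pi\<^sub>E UNIV W" "Pi\<^sub>E UNIV W \<subseteq> V"
    using V assms(2) U by (fastforce simp: openin_product_topology_alt)
  obtain n where n: "\<And>i. W i \<noteq> lcosets (H i) \<Longrightarrow> i \<le> n"
    using fin by (auto simp: finite_nat_set_iff_bounded_le)
  have xC: "x \<in> C" using assms(2) U by simp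
  have "y \<in> U" if "y \<in> cyl n (x n)" for y
  proof -
    have y: "y \<in> C" "y n = x n" using that by (auto simp: cyl_def)
    have "y i \<in> W i" for i
    proof (cases "i \<le> n")
      case True
      then have "y i = x i" using limit_coord_eq_below[OF y(1) xC] y(2) by blast
      then show ?thesis using W(1) by auto
    next
      case False
      then show ?thesis using n[of i] limit_coord[OF y(1)] by auto
    qed
    then show ?thesis using W(2) y(1) U by auto
  qed
  then show ?thesis using that by blast
qed

section \<open>Transversals\<close>

lemma transversal_exists:
  "\<exists>T. finite T \<and> T \<subseteq> H i \<and> (\<forall>h\<in>H i. \<exists>!t. t \<in> T \<and> t <# H (Suc i) = h <# H (Suc i))"
proof -
  define Q where "Q = lcosets\<^bsub>G\<lparr>carrier := H i\<rparr>\<^esub> H (Suc i)"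
  have Q: "Q = (\<lambda>a. a <# H (Suc i)) ` H i"
    by (auto simp: Q_def LCOSETS_def)
  have "finite Q"
    using chain by (auto simp: Q_def finite_index_chain_def)
  define f where "f A = (SOME a. a \<in> H i \<and> a <# H (Suc i) = A)" for A
  have f: "f A \<in> H i \<and> f A <# H (Suc i) = A" if "A \<in> Q" for A
    unfolding f_def using that
    by (intro someI_ex[where P = "\<lambda>a. a \<in> H i \<and> a <# H (Suc i) = A"]) (auto simp: Q)
  have "\<exists>!t. t \<in> f ` Q \<and> t <# H (Suc i) = h <# H (Suc i)" if "h \<in> H i" for h
  proof (rule ex1I[of _ "f (h <# H (Suc i))"])
    have "h <# H (Suc i) \<in> Q" using that by (auto simp: Q)
    then show "f (h <# H (Suc i)) \<in> f ` Q \<and> f (h <# H (Suc i)) <# H (Suc i) = h <# H (Suc i)"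
      using f by blast
  next
    fix t assume "t \<in> f ` Q \<and> t <# H (Suc i) = h <# H (Suc i)"
    then show "t = f (h <# H (Suc i))" using f by auto
  qed
  moreover have "f ` Q \<subseteq> H i" using f by blast
  ultimately show ?thesis
    using \<open>finite Q\<close> by (intro exI[of _ "f ` Q"] conjI ballI) simp_all
qed

text \<open>A finite set of representatives of the left cosets of \<open>H (Suc i)\<close> in \<open>H i\<close>.\<close>

definition T :: "nat \<Rightarrow> 'a set" where
  "T i = (SOME T. finite T \<and> T \<subseteq> H i \<and>
            (\<forall>h\<in>H i. \<exists>!t. t \<in> T \<and> t <# H (Suc i) = h <# H (Suc i)))"

lemma finite_T: "finite (T i)"
  and T_subset: "T i \<subseteq> H i"
  and T_ex1: "h \<in> H i \<Longrightarrow> \<exists>!t. t \<in> T i \<and> t <# H (Suc i) = h <# H (Suc i)"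
  using someI_ex[OF transversal_exists[of i]] unfolding T_def[symmetric] by blast+

lemma T_nonempty: "T i \<noteq> {}"
  using T_ex1[OF subgroup.one_closed[OF subgroup_H]] by blast

text \<open>The product \<open>t\<^sub>0 \<cdots> t\<^sub>i\<^sub>-\<^sub>1\<close> of the first \<open>i\<close> digits, in this order.\<close>

primrec partial_prod :: "(nat \<Rightarrow> 'a) \<Rightarrow> nat \<Rightarrow> 'a" where
  "partial_prod t 0 = \<one>"
| "partial_prod t (Suc i) = partial_prod t i \<otimes> t i"

text \<open>
  The point of the limit with the digits \<open>t\<close>.  Its coordinates are compatible when
  \<open>t i \<in> T i\<close> for all \<open>i\<close>, because then \<open>t i \<in> H i\<close>.
\<close>

definition point :: "(nat \<Rightarrow> 'a) \<Rightarrow> nat \<Rightarrow> 'a set" where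
  "point t i = partial_prod t i <# H i"

lemma digit_in_H: "t \<in> Pi UNIV T \<Longrightarrow> t i \<in> H i"
  using T_subset by blast

lemma partial_prod_closed: "t \<in> Pi UNIV T \<Longrightarrow> partial_prod t i \<in> carrier G"
  by (induction i) (auto intro: H_carrier digit_in_H)

lemma partial_prod_cong: "(\<And>j. j < i \<Longrightarrow> s j = t j) \<Longrightarrow> partial_prod s i = partial_prod t i"
  by (induction i) auto

lemma point_proj:
  assumes "t \<in> Pi UNIV T"
  shows "coset_proj G (H i) (point t (Suc i)) = point t i"
proof -
  have p: "partial_prod t i \<in> carrier G" and ti: "t i \<in> H i"
    using assms partial_prod_closed digit_in_H by auto
  have "coset_proj G (H i) (point t (Suc i)) = (partial_prod t i \<otimes> t i) <# H i"
    using p H_carrier[OF ti] by (simp add: point_def coset_proj_Suc)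
  also have "\<dots> = partial_prod t i <# H i"
    using p H_carrier[OF ti] ti
    by (subst eq_commute, subst l_coset_eq_iff) (auto simp flip: m_assoc)
  finally show ?thesis by (simp add: point_def)
qed

lemma point_in_limit: "t \<in> Pi UNIV T \<Longrightarrow> point t \<in> C"
  unfolding coset_limit_def using point_proj partial_prod_closed
  by (auto simp: point_def intro: l_coset_in_lcosets)

text \<open>
  Each coset of \<open>H i\<close> is \<open>t\<^sub>0 \<cdots> t\<^sub>i\<^sub>-\<^sub>1 H i\<close> for exactly one choice of the first \<open>i\<close>
  digits.  In terms of random digits, a coordinate having a given value is thus an event
  prescribing finitely many digits.
\<close>

lemma coset_digits:
  assumes "A \<in> lcosets (H i)"
  shows "\<exists>s\<in>Pi UNIV T. \<forall>t\<in>Pi UNIV T. point t i = A \<longleftrightarrow> (\<forall>j<i. t j = s j)"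
  using assms
proof (induction i arbitrary: A)
  case 0
  obtain a where a: "a \<in> carrier G" "A = a <# H 0" using 0 by (rule lcosetsE)
  have "A = \<one> <# H 0"
    unfolding a(2) using a(1) by (subst l_coset_eq_iff) (auto simp: H_0)
  moreover obtain s where "s \<in> Pi UNIV T"
    using T_nonempty by (metis PiE_eq_empty_iff all_not_in_conv PiE_UNIV_domain)
  ultimately show ?case by (auto simp: point_def)
next
  case (Suc i)
  obtain a where a: "a \<in> carrier G" "A = a <# H (Suc i)" using Suc.prems by (rule lcosetsE)
  obtain s where s: "s \<in> Pi UNIV T"
    and s_iff: "\<And>t. t \<in> Pi UNIV T \<Longrightarrow> point t i = a <# H i \<longleftrightarrow> (\<forall>j<i. t j = s j)"
    using Suc.IH[OF l_coset_in_lcosets[OF a(1)]] by blast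
  define p where "p = partial_prod s i"
  have p: "p \<in> carrier G" using s partial_prod_closed by (simp add: p_def)
  have "p <# H i = a <# H i" using s_iff[OF s] by (simp add: point_def p_def)
  then have pa: "inv p \<otimes> a \<in> H i" using l_coset_eq_iff p a(1) by blast
  obtain r where r: "r \<in> T i" "r <# H (Suc i) = (inv p \<otimes> a) <# H (Suc i)"
    and r_unique: "\<And>t. t \<in> T i \<Longrightarrow> t <# H (Suc i) = (inv p \<otimes> a) <# H (Suc i) \<Longrightarrow> t = r"
    using T_ex1[OF pa] by blast
  have shift: "(p \<otimes> t) <# H (Suc i) = A \<longleftrightarrow> t <# H (Suc i) = (inv p \<otimes> a) <# H (Suc i)"
    if "t \<in> carrier G" for t
    using that p a(1) by (simp add: a(2) l_coset_eq_iff inv_mult_group m_assoc)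
  show ?case
  proof (intro bexI ballI iffI)
    show "s(i := r) \<in> Pi UNIV T" using s r(1) by auto
  next
    fix t assume t: "t \<in> Pi UNIV T" and eq: "point t (Suc i) = A"
    have "point t i = a <# H i"
      using point_proj[OF t, of i] eq a by (simp add: coset_proj_Suc)
    then have low: "\<forall>j<i. t j = s j" using s_iff[OF t] by blast
    then have "partial_prod t i = p" unfolding p_def by (intro partial_prod_cong) auto
    moreover have "t i \<in> T i" using t by blast
    moreover have "t i \<in> carrier G" using digit_in_H[OF t] H_carrier by blast
    ultimately have "t i = r" using eq shift r_unique by (simp add: point_def)
    with low show "\<forall>j<Suc i. t j = (s(i := r)) j" by (simp add: less_Suc_eq)
  next
    fix t assume t: "t \<in> Pi UNIV T" and eq: "\<forall>j<Suc i. t j = (s(i := r)) j"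
    have "partial_prod t i = p" unfolding p_def using eq by (intro partial_prod_cong) auto
    moreover have "t i = r" using eq by simp
    moreover have "r \<in> carrier G" using r(1) T_subset H_carrier by blast
    ultimately show "point t (Suc i) = A" using shift r(2) by (simp add: point_def)
  qed
qed

lemma finite_lcosets: "finite (lcosets (H i))"
proof -
  let ?F = "Pi\<^sub>E {..<i} T"
  have "lcosets (H i) \<subseteq> (\<lambda>u. partial_prod u i <# H i) ` ?F"
  proof
    fix A assume "A \<in> lcosets (H i)"
    from coset_digits[OF this] obtain s where s: "s \<in> Pi UNIV T" "point s i = A" by auto
    have "restrict s {..<i} \<in> ?F" using s(1) by auto
    moreover have "partial_prod (restrict s {..<i}) i = partial_prod s i"
      by (intro partial_prod_cong) simp
    ultimately show "A \<in> (\<lambda>u. partial_prod u i <# H i) ` ?F"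
      using s(2) by (metis image_eqI point_def)
  qed
  then show ?thesis
    using finite_subset finite_PiE finite_T by (metis finite_imageI finite_lessThan)
qed

section \<open>Borel sets and equidistributed measures\<close>

lemma countable_cylinders: "countable cylinders"
proof -
  have "cylinders = (\<Union>i. cyl i ` (lcosets (H i)))"
    by (auto simp: cylinders_def)
  then show ?thesis
    using finite_lcosets by (simp add: countable_finite)
qed

lemma sets_Borel_cylinders: "sets Borel = sigma_sets C (insert {} cylinders)"
proof -
  have opens: "{U. openin (coset_limit_topology G H) U} \<subseteq> Pow C"
    using openin_subset topspace_coset_limit_topology by fastforce
  have "U \<in> sigma_sets C (insert {} cylinders)"
    if U: "openin (coset_limit_topology G H) U" for U
  proof -
    have "U = \<Union> {E \<in> cylinders. E \<subseteq> U}"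
    proof
      show "U \<subseteq> \<Union> {E \<in> cylinders. E \<subseteq> U}"
      proof
        fix x assume x: "x \<in> U"
        then have xC: "x \<in> C" using U opens by blast
        obtain n where "cyl n (x n) \<subseteq> U" using open_contains_cyl[OF U x] .
        moreover have "x \<in> cyl n (x n)" using xC by (simp add: cyl_def)
        ultimately show "x \<in> \<Union> {E \<in> cylinders. E \<subseteq> U}"
          using cyl_in_cylinders[OF limit_coord[OF xC]] by blast
      qed
    qed blast
    moreover have "\<Union> {E \<in> cylinders. E \<subseteq> U} \<in> sigma_sets C (insert {} cylinders)"
      by (rule sigma_sets_UNION) (auto intro: countable_subset[OF _ countable_cylinders])
    ultimately show ?thesis by simp
  qed
  moreover have "E \<in> sigma_sets C {U. openin (coset_limit_topology G H) U}"
    if "E \<in> insert {} cylinders" for E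
    using that openin_cyl by (auto simp: cylinders_def)
  ultimately have "sigma_sets C {U. openin (coset_limit_topology G H) U}
      = sigma_sets C (insert {} cylinders)"
    by (intro sigma_sets_eqI) auto
  then show ?thesis using opens by simp
qed

lemma space_Borel: "space Borel = C"
  by (simp add: space_measure_of_conv)

lemma cyl_in_Borel: "A \<in> lcosets (H i) \<Longrightarrow> cyl i A \<in> sets Borel"
  unfolding sets_Borel_cylinders using cyl_in_cylinders by auto

lemma measurable_into_Borel:
  assumes "f \<in> space N \<rightarrow> C"
    and "\<And>i A. A \<in> lcosets (H i) \<Longrightarrow> f -` cyl i A \<inter> space N \<in> sets N"
  shows "f \<in> measurable N Borel"
proof (rule measurable_sigma_sets[OF sets_Borel_cylinders])
  show "insert {} cylinders \<subseteq> Pow C"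
    using cyl_subset by (auto simp: cylinders_def)
qed (use assms in \<open>auto simp: cylinders_def\<close>)

text \<open>Borel probability measures which give equal mass to all cylinders of the same level.\<close>

definition equidistributed :: "(nat \<Rightarrow> 'a set) measure \<Rightarrow> bool" where
  "equidistributed \<mu> \<longleftrightarrow> sets \<mu> = sets Borel \<and> prob_space \<mu> \<and>
     (\<forall>i. \<forall>A\<in>lcosets (H i). \<forall>B\<in>lcosets (H i). emeasure \<mu> (cyl i A) = emeasure \<mu> (cyl i B))"

text \<open>The cylinders of level \<open>i\<close> partition the limit, so each has mass \<open>1 / [\<Gamma> : H i]\<close>.\<close>

lemma equidistributed_cyl:
  assumes "equidistributed \<mu>" "A \<in> lcosets (H i)"
  shows "of_nat (card (lcosets (H i))) * emeasure \<mu> (cyl i A) = 1"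
proof -
  interpret prob_space \<mu> using assms(1) by (simp add: equidistributed_def)
  have sets: "sets \<mu> = sets Borel" using assms(1) by (simp add: equidistributed_def)
  have "(\<Union>B\<in>lcosets (H i). cyl i B) = space \<mu>"
    using limit_coord by (auto simp: cyl_def sets_eq_imp_space_eq[OF sets] space_Borel)
  then have "1 = emeasure \<mu> (\<Union>B\<in>lcosets (H i). cyl i B)"
    by (simp add: emeasure_space_1)
  also have "\<dots> = (\<Sum>B\<in>lcosets (H i). emeasure \<mu> (cyl i B))"
    using cyl_in_Borel sets finite_lcosets
    by (intro sum_emeasure[symmetric]) (auto simp: disjoint_family_on_def cyl_def)
  also have "\<dots> = (\<Sum>B\<in>lcosets (H i). emeasure \<mu> (cyl i A))"
  proof (rule sum.cong[OF refl])
    fix B assume "B \<in> lcosets (H i)"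
    then show "emeasure \<mu> (cyl i B) = emeasure \<mu> (cyl i A)"
      using assms unfolding equidistributed_def by blast
  qed
  finally show ?thesis by simp
qed

lemma equidistributed_unique:
  assumes "equidistributed \<mu>" "equidistributed \<nu>"
  shows "\<mu> = \<nu>"
proof (rule measure_eqI_generator_eq_countable[OF Int_stable_cylinders,
      where \<Omega> = C and A = "cyl 0 ` (lcosets (H 0))"])
  show "insert {} cylinders \<subseteq> Pow C"
    using cyl_subset by (auto simp: cylinders_def)
  show "emeasure \<mu> E = emeasure \<nu> E" if E: "E \<in> insert {} cylinders" for E
  proof (cases "E = {}")
    case False
    then obtain i A where A: "A \<in> lcosets (H i)" "E = cyl i A"
      using E by (auto simp: cylinders_def)
    let ?n = "of_nat (card (lcosets (H i))) :: ennreal"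
    have "card (lcosets (H i)) \<noteq> 0" using A(1) finite_lcosets by auto
    moreover have "?n * emeasure \<mu> E = ?n * emeasure \<nu> E"
      using equidistributed_cyl[OF assms(1) A(1)] equidistributed_cyl[OF assms(2) A(1)] A(2)
      by simp
    ultimately show ?thesis by (simp add: ennreal_mult_cancel_left)
  qed simp
  show "sets \<mu> = sigma_sets C (insert {} cylinders)" "sets \<nu> = sigma_sets C (insert {} cylinders)"
    using assms sets_Borel_cylinders by (auto simp: equidistributed_def)
  show "cyl 0 ` (lcosets (H 0)) \<subseteq> insert {} cylinders"
    using cyl_in_cylinders by blast
  show "\<Union> (cyl 0 ` (lcosets (H 0))) = C"
    using limit_coord by (auto simp: cyl_def)
  show "countable (cyl 0 ` (lcosets (H 0)))"
    using finite_lcosets by (simp add: countable_finite)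
  show "emeasure \<mu> E \<noteq> \<infinity>" for E
  proof -
    interpret prob_space \<mu> using assms(1) by (simp add: equidistributed_def)
    show ?thesis by simp
  qed
qed

lemma equidistributed_exists: "\<exists>\<mu>. equidistributed \<mu>"
proof -
  define U where "U i = uniform_count_measure (T i)" for i
  define P where "P = PiM UNIV U"
  interpret product_prob_space U UNIV
    unfolding U_def
    by (intro product_prob_spaceI prob_space_uniform_count_measure finite_T T_nonempty)
  have spaceP: "space P = Pi UNIV T"
    by (simp add: P_def space_PiM U_def space_uniform_count_measure PiE_UNIV_domain)
  have sing: "{a} \<in> sets (U j)" if "a \<in> T j" for a j
    using that by (simp add: U_def sets_uniform_count_measure)
  have preimage: "\<exists>s\<in>Pi UNIV T. point -` cyl i A \<inter> space P = {t \<in> space P. \<forall>j\<in>{..<i}. t j \<in> {s j}}"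
    if A: "A \<in> lcosets (H i)" for i A
  proof -
    obtain s where "s \<in> Pi UNIV T" "\<forall>t\<in>Pi UNIV T. point t i = A \<longleftrightarrow> (\<forall>j<i. t j = s j)"
      using coset_digits[OF A] by blast
    then show ?thesis
      using point_in_limit by (intro bexI[of _ s]) (auto simp: cyl_def spaceP)
  qed
  have mass: "emeasure P {t \<in> space P. \<forall>j\<in>{..<i}. t j \<in> {s j}} = (\<Prod>j<i. ennreal (1 / card (T j)))"
    if s: "s \<in> Pi UNIV T" for s i
  proof -
    have sj: "s j \<in> T j" for j using s by blast
    have "emeasure P {t \<in> space P. \<forall>j\<in>{..<i}. t j \<in> {s j}} = (\<Prod>j<i. emeasure (U j) {s j})"
      unfolding P_def by (rule emeasure_PiM_Collect) (auto intro: sing sj)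
    also have "\<dots> = (\<Prod>j<i. ennreal (1 / card (T j)))"
      using sj finite_T by (intro prod.cong) (simp_all add: U_def emeasure_uniform_count_measure)
    finally show ?thesis .
  qed
  have meas: "point \<in> measurable P Borel"
  proof (rule measurable_into_Borel)
    show "point \<in> space P \<rightarrow> C" using point_in_limit by (auto simp: spaceP)
    fix i A assume "A \<in> lcosets (H i)"
    then obtain s where s: "s \<in> Pi UNIV T"
      and eq: "point -` cyl i A \<inter> space P = {t \<in> space P. \<forall>j\<in>{..<i}. t j \<in> {s j}}"
      using preimage by blast
    have "s j \<in> T j" for j using s by blast
    then have "{t \<in> space P. t j \<in> {s j}} \<in> sets P" for j
      unfolding P_def by (intro sets_Collect_single sing) auto
    then show "point -` cyl i A \<inter> space P \<in> sets P"
      unfolding eq by (intro sets.sets_Collect_finite_All) auto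
  qed
  have "emeasure (distr P Borel point) (cyl i A) = (\<Prod>j<i. ennreal (1 / card (T j)))"
    if "A \<in> lcosets (H i)" for i A
    using preimage[OF that] mass by (auto simp: emeasure_distr[OF meas cyl_in_Borel[OF that]])
  moreover have "prob_space (distr P Borel point)"
    using meas P.prob_space_distr by (simp add: P_def)
  ultimately show ?thesis
    unfolding equidistributed_def by (intro exI[of _ "distr P Borel point"]) simp
qed

section \<open>Unique ergodicity of the translation action\<close>

lemma translation_limit: "g \<in> carrier G \<Longrightarrow> x \<in> C \<Longrightarrow> translation G g x \<in> C"
  by (rule translation_in_coset_limit) auto

lemma translation_preimage_cyl:
  assumes g: "g \<in> carrier G" and A: "A \<in> lcosets (H i)"
  shows "{x \<in> C. translation G g x \<in> cyl i A} = cyl i (inv g <# A)"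
    and "inv g <# A \<in> lcosets (H i)"
proof -
  obtain a where a: "a \<in> carrier G" "A = a <# H i" using A by (rule lcosetsE)
  show "inv g <# A \<in> lcosets (H i)"
    using a g by (simp add: lcos_m_assoc l_coset_in_lcosets)
  have "g <# x i = A \<longleftrightarrow> x i = inv g <# A" if x: "x \<in> C" for x
  proof -
    obtain b where b: "b \<in> carrier G" "x i = b <# H i"
      using limit_coord[OF x] by (rule lcosetsE)
    have "g <# (inv g <# A) = A" "inv g <# (g <# x i) = x i"
      using g a b by (simp_all add: lcos_m_assoc flip: m_assoc)
    then show ?thesis by metis
  qed
  then show "{x \<in> C. translation G g x \<in> cyl i A} = cyl i (inv g <# A)"
    using translation_limit[OF g] by (auto simp: cyl_def translation_def)
qed

lemma translation_measurable:
  assumes "g \<in> carrier G"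
  shows "translation G g \<in> measurable Borel Borel"
proof (rule measurable_into_Borel)
  show "translation G g \<in> space Borel \<rightarrow> C"
    using translation_limit[OF assms] by (auto simp: space_Borel)
  fix i A assume A: "A \<in> lcosets (H i)"
  have "translation G g -` cyl i A \<inter> space Borel = cyl i (inv g <# A)"
    unfolding space_Borel translation_preimage_cyl(1)[OF assms A, symmetric] by blast
  then show "translation G g -` cyl i A \<inter> space Borel \<in> sets Borel"
    using cyl_in_Borel translation_preimage_cyl(2)[OF assms A] by simp
qed

text \<open>
  From left to right, the transitivity of the action on cosets is used; from right to left,
  the translates of an equidistributed measure are equidistributed, hence equal to it.
\<close>

lemma invariant_iff_equidistributed:
  "invariant_borel_prob G (coset_limit_topology G H) (translation G) \<mu> \<longleftrightarrow> equidistributed \<mu>"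
proof
  assume inv: "invariant_borel_prob G (coset_limit_topology G H) (translation G) \<mu>"
  then have sets: "sets \<mu> = sets Borel" and prob: "prob_space \<mu>"
    and invD: "\<And>g E. g \<in> carrier G \<Longrightarrow> E \<in> sets \<mu> \<Longrightarrow>
      emeasure \<mu> {x \<in> C. translation G g x \<in> E} = emeasure \<mu> E"
    by (auto simp: invariant_borel_prob_def topspace_coset_limit_topology)
  have mass: "emeasure \<mu> (cyl i A) = emeasure \<mu> (cyl i B)"
    if A: "A \<in> lcosets (H i)" and B: "B \<in> lcosets (H i)" for i A B
  proof -
    obtain a where a: "a \<in> carrier G" "A = a <# H i" using A by (rule lcosetsE)
    obtain b where b: "b \<in> carrier G" "B = b <# H i" using B by (rule lcosetsE)
    define g where "g = a \<otimes> inv b"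
    have g: "g \<in> carrier G" using a b by (simp add: g_def)
    have "inv g <# A = B"
      using a b by (simp add: g_def lcos_m_assoc inv_mult_group m_assoc)
    then have "{x \<in> C. translation G g x \<in> cyl i A} = cyl i B"
      using translation_preimage_cyl(1)[OF g A] by (simp only:)
    moreover have "cyl i A \<in> sets \<mu>" using cyl_in_Borel[OF A] by (simp only: sets)
    ultimately show ?thesis using invD[OF g, of "cyl i A"] by (simp only:)
  qed
  show "equidistributed \<mu>"
    unfolding equidistributed_def by (intro conjI allI ballI sets prob mass)
next
  assume eq: "equidistributed \<mu>"
  then have sets: "sets \<mu> = sets Borel" and prob: "prob_space \<mu>"
    by (auto simp: equidistributed_def)
  have space: "space \<mu> = C"
    using sets_eq_imp_space_eq[OF sets] space_Borel by simp
  have "emeasure \<mu> {x \<in> C. translation G g x \<in> E} = emeasure \<mu> E"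
    if g: "g \<in> carrier G" and E: "E \<in> sets \<mu>" for g E
  proof -
    have meas: "translation G g \<in> measurable \<mu> Borel"
      using translation_measurable[OF g] measurable_cong_sets[OF sets refl] by blast
    define \<nu> where "\<nu> = distr \<mu> Borel (translation G g)"
    have \<nu>: "emeasure \<nu> F = emeasure \<mu> {x \<in> C. translation G g x \<in> F}" if "F \<in> sets Borel" for F
      using emeasure_distr[OF meas that]
      by (simp add: \<nu>_def space vimage_def Int_def conj_commute)
    have \<nu>_cyl: "emeasure \<nu> (cyl i A) = emeasure \<mu> (cyl i (inv g <# A))"
      if "A \<in> lcosets (H i)" for i A
      by (simp only: \<nu>[OF cyl_in_Borel[OF that]] translation_preimage_cyl(1)[OF g that])
    have "emeasure \<nu> (cyl i A) = emeasure \<nu> (cyl i B)"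
      if A: "A \<in> lcosets (H i)" and B: "B \<in> lcosets (H i)" for i A B
      unfolding \<nu>_cyl[OF A] \<nu>_cyl[OF B]
      using eq translation_preimage_cyl(2)[OF g A] translation_preimage_cyl(2)[OF g B]
      unfolding equidistributed_def by blast
    moreover have "sets \<nu> = sets Borel"
      by (simp only: \<nu>_def sets_distr)
    moreover have "prob_space \<nu>"
      unfolding \<nu>_def by (rule prob_space.prob_space_distr[OF prob meas])
    ultimately have "equidistributed \<nu>"
      unfolding equidistributed_def by (intro conjI allI ballI)
    then have "\<nu> = \<mu>" using eq by (rule equidistributed_unique)
    then show ?thesis using \<nu>[of E] E sets by simp
  qed
  then show "invariant_borel_prob G (coset_limit_topology G H) (translation G) \<mu>"
    using sets prob by (simp add: invariant_borel_prob_def topspace_coset_limit_topology)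
qed

lemma uniquely_ergodic_translation:
  "uniquely_ergodic G (coset_limit_topology G H) (translation G)"
  unfolding uniquely_ergodic_def invariant_iff_equidistributed
  using equidistributed_exists equidistributed_unique by blast

end

theorem theorem6p2:
  fixes M :: "'a::euclidean_space set"
    and m0 :: 'a
    and d :: nat
    and H :: "nat \<Rightarrow> (real \<Rightarrow> 'a) set set"
  assumes "pl_manifold d M"
    and "compact M"
    and "connected M"
    and "orientable d (top_of_set M)"
    and "m0 \<in> M"
    and "finite_index_chain (fundamental_group M m0) H"
  shows "uniquely_ergodic (fundamental_group M m0)
           (coset_limit_topology (fundamental_group M m0) H)
           (translation (fundamental_group M m0))"
proof -
  have "coset_chain (fundamental_group M m0) H"
    unfolding coset_chain_def coset_chain_axioms_def
    using assms(5,6) group_fundamental_group by blast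
  then show ?thesis
    by (rule coset_chain.uniquely_ergodic_translation)
qed

end
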